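(* Let $N,K,n$ be nonnegative integers with $K\le N$ and $n\le N$, and let $X$ be a random variable with the hypergeometric distribution with parameters $(N,K,n)$. Then for every $t\in\mathbb{R}$ the moment-generating function $M_X(t)=E[e^{tX}]$ and the characteristic function $\varphi_X(t)=E[e^{itX}]$ (with $i=\sqrt{-1}$) of $X$ are $$ M_X(t)=\begin{cases} \dfrac{(N-n)!\,(N-K)!}{N!\,(N-K-n)!}\;{}_2F_1(-n,-K;\,N-K-n+1;\,e^t) & \text{if } n\le N-K,\\[3mm] \dfrac{n!\,K!}{N!\,(n+K-N)!}\;e^{(n+K-N)t}\;{}_2F_1(n-N,K-N;\,n+K-N+1;\,e^t) & \text{if } n\ge N-K+1, \end{cases} $$ and $$ \varphi_X(t)=\begin{cases} \dfrac{(N-n)!\,(N-K)!}{N!\,(N-K-n)!}\;{}_2F_1(-n,-K;\,N-K-n+1;\,e^{it}) & \text{if } n\le N-K,\\[3mm] \dfrac{n!\,K!}{N!\,(n+K-N)!}\;e^{i(n+K-N)t}\;{}_2F_1(n-N,K-N;\,n+K-N+1;\,e^{it}) & \text{if } n\ge N-K+1. \end{cases} $$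
   Context: Hypergeometric distribution: an urn contains $K$ white balls and $N-K$ black balls; $n$ balls are drawn at random without replacement, and $X$ is the number of white balls drawn. Thus $\Pr(X=k)=\binom{K}{k}\binom{N-K}{n-k}\big/\binom{N}{n}$, which is nonzero exactly for integers $k$ with $\max\{0,n+K-N\}\le k\le\min\{n,K\}$ (binomial coefficients with lower index negative or exceeding the upper index are $0$). Gauss hypergeometric function: ${}_2F_1(a,b;c;z)=\sum_{k=0}^\infty \frac{(a)_k(b)_k}{(c)_k}\frac{z^k}{k!}$, where $(a)_0=1$ and $(a)_k=a(a+1)\cdots(a+k-1)$ is the Pochhammer symbol. It is defined when $c$ is not zero or a negative integer. In the claim the first two arguments are nonpositive integers and the third is a positive integer, so each series is a finite sum. *)

theory Defs
  imports "HOL-Probability.Probability"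
begin

text \<open>The urn model: the balls are \<open>0, \<dots>, N - 1\<close>, the white ones are \<open>0, \<dots>, K - 1\<close>, and
  a draw of \<open>n\<close> balls without replacement is a uniformly random \<open>n\<close>-element subset.
  Only meaningful for \<open>K \<le> N\<close> and \<open>n \<le> N\<close>.\<close>

definition hypergeometric_pmf :: "nat \<Rightarrow> nat \<Rightarrow> nat \<Rightarrow> nat pmf" where
  "hypergeometric_pmf N K n =
     map_pmf (\<lambda>S. card (S \<inter> {..<K})) (pmf_of_set {S. S \<subseteq> {..<N} \<and> card S = n})"

lemma pmf_hypergeometric:
  fixes N K n k :: nat
  assumes "K \<le> N" "n \<le> N"
  shows "pmf (hypergeometric_pmf N K n) k =
    (if k \<le> n then real (K choose k) * real ((N - K) choose (n - k)) / real (N choose n) else 0)"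
proof -
  let ?D = "{S. S \<subseteq> {..<N} \<and> card S = n}"
  let ?E = "{S \<in> ?D. card (S \<inter> {..<K}) = k}"
  have fin: "finite ?D" by (rule finite_subset[of _ "Pow {..<N}"]) auto
  have cD: "card ?D = N choose n" using n_subsets[of "{..<N}" n] by simp
  have "?D \<noteq> {}" using cD assms by (metis binomial_eq_0_iff card.empty not_less)
  then have "pmf (hypergeometric_pmf N K n) k = real (card ?E) / real (card ?D)"
    using fin unfolding hypergeometric_pmf_def
    by (simp add: pmf_map measure_pmf_of_set vimage_def Int_def)
  moreover have "card ?E = (if k \<le> n then (K choose k) * ((N - K) choose (n - k)) else 0)"
  proof (cases "k \<le> n")
    case True
    let ?A = "{A. A \<subseteq> {..<K} \<and> card A = k}" and ?B = "{B. B \<subseteq> {K..<N} \<and> card B = n - k}"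
    have "bij_betw (\<lambda>(A, B). A \<union> B) (?A \<times> ?B) ?E"
    proof (rule bij_betwI[where g = "\<lambda>S. (S \<inter> {..<K}, S \<inter> {K..<N})"])
      show "(\<lambda>(A, B). A \<union> B) \<in> ?A \<times> ?B \<rightarrow> ?E"
      proof (clarsimp, intro conjI)
        fix A B assume *: "A \<subseteq> {..<K}" "k = card A" "B \<subseteq> {K..<N}" "card B = n - card A"
        have lt: "x < K" if "x \<in> A" for x using * that by auto
        have ge: "K \<le> x" "x < N" if "x \<in> B" for x using * that by auto
        have d: "A \<inter> B = {}" using lt ge(1) leD by blast
        have f: "finite A" "finite B" using * finite_subset by blast+
        show "A \<subseteq> {..<N}" "B \<subseteq> {..<N}" using lt ge(2) assms(1) by (meson lessThan_iff less_le_trans subsetI)+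
        show "card (A \<union> B) = n" using card_Un_disjoint[OF f d] * True by simp
        have "(A \<union> B) \<inter> {..<K} = A" using lt ge(1) leD by blast
        then show "card ((A \<union> B) \<inter> {..<K}) = card A" by simp
      qed
      show "(\<lambda>S. (S \<inter> {..<K}, S \<inter> {K..<N})) \<in> ?E \<rightarrow> ?A \<times> ?B"
      proof
        fix S assume S: "S \<in> ?E"
        then have *: "S \<subseteq> {..<N}" by simp
        have "finite S" using * finite_subset by blast
        then have "card S = card (S \<inter> {..<K}) + card (S - {..<K})"
          by (rule card_Int_Diff)
        moreover have "S - {..<K} = S \<inter> {K..<N}" using * by (auto simp: subset_iff)
        ultimately have "card (S \<inter> {K..<N}) = card S - card (S \<inter> {..<K})" by simp
        then show "(S \<inter> {..<K}, S \<inter> {K..<N}) \<in> ?A \<times> ?B" using S by simp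
      qed
      show "(\<lambda>S. (S \<inter> {..<K}, S \<inter> {K..<N})) ((\<lambda>(A, B). A \<union> B) x) = x"
        if "x \<in> ?A \<times> ?B" for x
      proof -
        obtain A B where "x = (A, B)" and A: "A \<subseteq> {..<K}" and B: "B \<subseteq> {K..<N}"
          using \<open>x \<in> _\<close> by blast
        moreover have "A \<inter> {K..<N} = {}" "B \<inter> {..<K} = {}" using A B by (auto simp: subset_iff)
        ultimately show ?thesis by (simp add: Int_Un_distrib2 Int_absorb2)
      qed
      show "(\<lambda>(A, B). A \<union> B) ((\<lambda>S. (S \<inter> {..<K}, S \<inter> {K..<N})) S) = S"
        if "S \<in> ?E" for S
        using \<open>S \<in> ?E\<close> by auto
    qed
    then have "card ?E = card ?A * card ?B"
      by (simp only: bij_betw_same_card[symmetric] card_cartesian_product[symmetric])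
    also have "\<dots> = (K choose k) * ((N - K) choose (n - k))"
      using n_subsets[of "{..<K}" k] n_subsets[of "{K..<N}" "n - k"] by simp
    finally show ?thesis using True by simp
  next
    case False
    have "card (S \<inter> {..<K}) \<le> card S" if "S \<subseteq> {..<N}" for S
      using that by (intro card_mono) (auto intro: finite_subset)
    then have "?E = {}" using False by fastforce
    then have "card ?E = 0" by (simp only: card.empty)
    then show ?thesis using False by simp
  qed
  ultimately show ?thesis using cD by simp
qed

text \<open>The moment generating function of a distribution on the reals, the analogue of the
  library's characteristic function \<^const>\<open>char\<close>.\<close>

definition mgf :: "real measure \<Rightarrow> real \<Rightarrow> real" where
  "mgf M t = (LINT x|M. exp (t * x))"

lemma mgf_distr:
  assumes "X \<in> borel_measurable M"
  shows "mgf (distr M borel X) t = (LINT \<omega>|M. exp (t * X \<omega>))"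
  unfolding mgf_def using assms by (subst integral_distr) auto

lemma char_distr_eq:
  assumes "X \<in> borel_measurable M"
  shows "char (distr M borel X) t = (CLINT \<omega>|M. exp (\<i> * t * X \<omega>))"
  unfolding char_def using assms by (subst integral_distr) (auto simp: mult.assoc)

text \<open>The Gauss hypergeometric function, for \<open>c\<close> not zero or a negative integer.\<close>

definition hyp2F1 :: "'a \<Rightarrow> 'a \<Rightarrow> 'a \<Rightarrow> 'a \<Rightarrow> 'a::real_normed_field" where
  "hyp2F1 a b c z =
     (\<Sum>k. pochhammer a k * pochhammer b k / pochhammer c k * (z ^ k / fact k))"

lemma hyp2F1_eq_eval_fps:
  fixes z :: "'a :: {banach, real_normed_field}"
  shows "hyp2F1 a b c z = eval_fps (fps_hypergeo [a, b] [c] 1) z"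
  unfolding hyp2F1_def eval_fps_def by simp

end

theory Submission
  imports Defs
begin

text \<open>With \<open>d = N - K - n\<close> or \<open>d = n + K - N\<close>, the Pochhammer symbols of the truncated series are
  quotients of factorials, which recombine to the weights \<open>(a choose k) (b + d choose d + k)\<close>.
  By the symmetry of binomial coefficients these are the hypergeometric weights at \<open>k\<close> in the first
  case and at \<open>d + k\<close> in the second. Both transforms are the probability generating
  function, evaluated at \<open>e\<^sup>t\<close> and at \<open>e\<^sup>i\<^sup>t\<close>.\<close>

text \<open>Split \<open>pochhammer 1 (d + k)\<close> after \<open>d\<close> factors: both
  \<open>pochhammer 1 (d + k)\<close> and the first block are factorials.\<close>

lemma pochhammer_of_nat_plus_one:
  "pochhammer (of_nat d + 1 :: 'a::field_char_0) k = fact (d + k) / fact d"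
  using pochhammer_product'[of "1::'a" d k] fact_nonzero[of d, where 'a = 'a]
  by (simp add: pochhammer_fact[symmetric] add.commute nonzero_eq_divide_eq mult.commute)

lemma pochhammer_minus_of_nat:
  "pochhammer (- of_nat a :: 'a::field_char_0) k = (-1) ^ k * fact k * of_nat (a choose k)"
  using pochhammer_minus[of "of_nat a :: 'a" k] gbinomial_pochhammer[of "of_nat a :: 'a" k]
  by (simp add: binomial_gbinomial flip: mult.assoc power_mult_distrib)

text \<open>For \<open>k \<le> b\<close> both sides equal
  \<open>fact b / (fact (b - k) * fact (d + k))\<close>; for \<open>k > b\<close> both binomial
  coefficients vanish.\<close>

lemma fact_mult_choose_div_fact:
  "fact k * of_nat (b choose k) / fact (d + k)
    = (fact b / fact (b + d) * of_nat (b + d choose (d + k)) :: 'a::field_char_0)"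
proof (cases "k \<le> b")
  case True
  then have "b + d - (d + k) = b - k" by simp
  with True show ?thesis
    by (simp add: binomial_fact[of k b] binomial_fact[of "d + k" "b + d"])
qed (simp add: binomial_eq_0)

lemma hyp2F1_neg_of_nat:
  fixes z :: "'a::real_normed_field"
  assumes "b \<le> m \<or> a \<le> m"
  shows "hyp2F1 (- of_nat b) (- of_nat a) (of_nat d + 1) z =
    fact b * fact d / fact (b + d) *
      (\<Sum>k\<le>m. of_nat (a choose k) * of_nat (b + d choose (d + k)) * z ^ k)"
proof -
  have summand: "pochhammer (- of_nat b) k * pochhammer (- of_nat a) k / pochhammer (of_nat d + 1) k
      * (z ^ k / fact k) = fact b * fact d / fact (b + d) *
        (of_nat (a choose k) * of_nat (b + d choose (d + k)) * z ^ k)" for k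
  proof -
    have "pochhammer (- of_nat b) k * pochhammer (- of_nat a) k / pochhammer (of_nat d + 1) k
        * (z ^ k / fact k)
      = (fact k * of_nat (b choose k) / fact (d + k)) * fact d * of_nat (a choose k) * z ^ k"
      \<comment> \<open>The two signs \<open>(-1) ^ k\<close> cancel, and one of the two factors
        \<open>fact k\<close> cancels the denominator of \<open>z ^ k / fact k\<close>.\<close>
      unfolding pochhammer_minus_of_nat pochhammer_of_nat_plus_one
      by (simp add: field_simps flip: power_mult_distrib)
    then show ?thesis by (simp add: fact_mult_choose_div_fact)
  qed
  have "hyp2F1 (- of_nat b) (- of_nat a) (of_nat d + 1) z =
    (\<Sum>k\<le>m. fact b * fact d / fact (b + d) *
        (of_nat (a choose k) * of_nat (b + d choose (d + k)) * z ^ k))"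
    \<comment> \<open>Beyond \<open>m\<close> one binomial coefficient is zero:
      \<open>a choose k\<close> if \<open>a \<le> m\<close>, \<open>b + d choose (d + k)\<close> if
      \<open>b \<le> m\<close>.\<close>
    unfolding hyp2F1_def summand using assms by (intro suminf_finite) auto
  then show ?thesis by (simp add: sum_distrib_left)
qed

text \<open>The field is left general so that one identity serves the real argument of the moment
  generating function and the complex one of the characteristic function.\<close>

definition hypergeometric_pgf :: "nat \<Rightarrow> nat \<Rightarrow> nat \<Rightarrow> 'a \<Rightarrow> 'a::real_normed_field" where
  "hypergeometric_pgf N K n z =
     (\<Sum>k\<le>n. of_nat (K choose k) * of_nat (N - K choose (n - k)) * z ^ k) / of_nat (N choose n)"

lemma integral_hypergeometric_pmf_power:
  fixes z :: "'a::{real_normed_field, banach, second_countable_topology}"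
  assumes "K \<le> N" "n \<le> N"
  shows "(LINT k|measure_pmf (hypergeometric_pmf N K n). z ^ k) = hypergeometric_pgf N K n z"
proof -
  have "(LINT k|measure_pmf (hypergeometric_pmf N K n). z ^ k)
      = (\<Sum>k\<le>n. pmf (hypergeometric_pmf N K n) k *\<^sub>R z ^ k)"
  proof (rule integral_measure_pmf)
    show "k \<in> {..n}" if "k \<in> set_pmf (hypergeometric_pmf N K n)" for k
      using that assms by (auto simp: set_pmf_iff pmf_hypergeometric split: if_splits)
  qed simp
  also have "\<dots> = hypergeometric_pgf N K n z"
    by (simp add: assms pmf_hypergeometric hypergeometric_pgf_def sum_divide_distrib scaleR_conv_of_real)
  finally show ?thesis .
qed

lemma hypergeometric_pgf_hyp2F1:
  fixes z :: "'a::real_normed_field"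
  assumes "K \<le> N" "n \<le> N - K"
  shows "hypergeometric_pgf N K n z =
    fact (N - n) * fact (N - K) / (fact N * fact (N - K - n))
    * hyp2F1 (- of_nat n) (- of_nat K) (of_nat N - of_nat K - of_nat n + 1) z"
proof -
  define d where "d = N - K - n"
  have N: "N = K + n + d" using assms by (simp add: d_def)
  have "(of_nat N - of_nat K - of_nat n + 1 :: 'a) = of_nat d + 1" by (simp add: N)
  moreover have "(n + d choose (d + k)) = (n + d choose (n - k))" if "k \<le> n" for k
    using that binomial_symmetric[of "d + k" "n + d"] by simp
  ultimately show ?thesis
    \<comment> \<open>Since \<open>N - K = n + d\<close>, the constants reduce to
      \<open>fact n * fact (N - n) / fact N\<close>, the inverse of
      \<open>N choose n\<close>.\<close>
    by (simp add: hypergeometric_pgf_def hyp2F1_neg_of_nat[of n n] N binomial_fact[of n "K + n + d"])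
qed

lemma hypergeometric_pgf_hyp2F1_reflected:
  fixes z :: "'a::real_normed_field"
  assumes "K \<le> N" "n \<le> N" "N - K \<le> n"
  shows "hypergeometric_pgf N K n z =
    fact n * fact K / (fact N * fact (n + K - N)) * z ^ (n + K - N)
    * hyp2F1 (of_nat n - of_nat N) (of_nat K - of_nat N) (of_nat n + of_nat K - of_nat N + 1) z"
proof -
  \<comment> \<open>Here \<open>a\<close> counts the black balls, \<open>b\<close> the balls left
    undrawn, and \<open>d\<close> is the least possible number of white balls drawn.\<close>
  define a b d where "a = N - K" and "b = N - n" and "d = n + K - N"
  have params: "n = a + d" "K = b + d" "N = a + b + d"
    using assms by (simp_all add: a_def b_def d_def)
  have "(\<Sum>k\<le>n. of_nat (K choose k) * of_nat (a choose (n - k)) * z ^ k)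
      = (\<Sum>k\<in>{d..a + d}. of_nat (K choose k) * of_nat (a choose (n - k)) * z ^ k)"
    \<comment> \<open>For \<open>k < d\<close> the draw would need \<open>n - k > a\<close> black
      balls, so the weight is zero.\<close>
    by (rule sum.mono_neutral_right) (auto simp: params)
  also have "\<dots> = (\<Sum>j\<le>a. of_nat (K choose (d + j)) * of_nat (a choose (a - j)) * z ^ (d + j))"
    by (rule sum.reindex_bij_witness[of _ "\<lambda>j. d + j" "\<lambda>k. k - d"]) (auto simp: params)
  also have "\<dots> = z ^ d * (\<Sum>j\<le>a. of_nat (a choose j) * of_nat (b + d choose (d + j)) * z ^ j)"
    unfolding sum_distrib_left
    by (rule sum.cong) (auto simp: params power_add mult_ac simp flip: binomial_symmetric)
  finally have "hypergeometric_pgf N K n z = z ^ d *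
      (\<Sum>j\<le>a. of_nat (a choose j) * of_nat (b + d choose (d + j)) * z ^ j) / of_nat (N choose n)"
    by (simp add: hypergeometric_pgf_def a_def)
  moreover have "(of_nat n - of_nat N :: 'a) = - of_nat b" "(of_nat K - of_nat N :: 'a) = - of_nat a"
    "(of_nat n + of_nat K - of_nat N + 1 :: 'a) = of_nat d + 1"
    by (simp_all add: params)
  \<comment> \<open>With \<open>K = b + d\<close> and \<open>N - n = b\<close> the constants again
    collapse to the inverse of \<open>N choose n\<close>.\<close>
  ultimately show ?thesis
    by (simp add: hyp2F1_neg_of_nat[of b a a] params binomial_fact[of "a + d" "a + b + d"])
qed

text \<open>The variable takes natural values \<open>k\<close>, so \<open>exp (t * k)\<close> is the
  power \<open>exp t ^ k\<close>.\<close>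

lemma mgf_hypergeometric:
  assumes "K \<le> N" "n \<le> N"
  shows "mgf (distr (measure_pmf (hypergeometric_pmf N K n)) borel real) t
    = hypergeometric_pgf N K n (exp t)"
  using assms
  by (simp add: mgf_distr mult.commute[of t] exp_of_nat_mult integral_hypergeometric_pmf_power)

lemma char_hypergeometric:
  assumes "K \<le> N" "n \<le> N"
  shows "char (distr (measure_pmf (hypergeometric_pmf N K n)) borel real) t
    = hypergeometric_pgf N K n (exp (\<i> * of_real t))"
  using assms
  by (simp add: char_distr_eq mult.commute[of "_ * _" "of_nat _"] exp_of_nat_mult
      integral_hypergeometric_pmf_power)

theorem corollary1p1:
  fixes M :: "'a measure" and X :: "'a \<Rightarrow> real" and N K n :: nat and t :: real
  assumes "prob_space M"
    and "K \<le> N" and "n \<le> N"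
    and "X \<in> borel_measurable M"
    and "distr M borel X = distr (measure_pmf (hypergeometric_pmf N K n)) borel real"
  shows
    "(n \<le> N - K \<longrightarrow>
       mgf (distr M borel X) t =
         fact (N - n) * fact (N - K) / (fact N * fact (N - K - n))
         * hyp2F1 (- real n) (- real K) (real N - real K - real n + 1) (exp t))
     \<and> (n \<ge> N - K + 1 \<longrightarrow>
       mgf (distr M borel X) t =
         fact n * fact K / (fact N * fact (n + K - N))
         * exp ((real n + real K - real N) * t)
         * hyp2F1 (real n - real N) (real K - real N) (real n + real K - real N + 1) (exp t))
     \<and> (n \<le> N - K \<longrightarrow>
       char (distr M borel X) t =
         fact (N - n) * fact (N - K) / (fact N * fact (N - K - n))
         * hyp2F1 (- of_nat n) (- of_nat K) (of_nat N - of_nat K - of_nat n + 1)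
             (exp (\<i> * of_real t)))
     \<and> (n \<ge> N - K + 1 \<longrightarrow>
       char (distr M borel X) t =
         fact n * fact K / (fact N * fact (n + K - N))
         * exp (\<i> * (of_nat n + of_nat K - of_nat N) * of_real t)
         * hyp2F1 (of_nat n - of_nat N) (of_nat K - of_nat N)
             (of_nat n + of_nat K - of_nat N + 1) (exp (\<i> * of_real t)))"
proof (intro conjI impI)
  note distribution = \<open>distr M borel X = _\<close>
  show "mgf (distr M borel X) t =
      fact (N - n) * fact (N - K) / (fact N * fact (N - K - n))
      * hyp2F1 (- real n) (- real K) (real N - real K - real n + 1) (exp t)"
    if "n \<le> N - K"
    using assms that by (simp add: distribution mgf_hypergeometric hypergeometric_pgf_hyp2F1)
  show "char (distr M borel X) t =
      fact (N - n) * fact (N - K) / (fact N * fact (N - K - n))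
      * hyp2F1 (- of_nat n) (- of_nat K) (of_nat N - of_nat K - of_nat n + 1) (exp (\<i> * of_real t))"
    if "n \<le> N - K"
    using assms that by (simp add: distribution char_hypergeometric hypergeometric_pgf_hyp2F1)
  assume "n \<ge> N - K + 1"
  then have le: "N - K \<le> n" "N \<le> n + K" by simp_all
  \<comment> \<open>As \<open>N \<le> n + K\<close>, the difference of casts is the cast of the
    natural number \<open>n + K - N\<close>, which turns the exponential into a power.\<close>
  have "exp ((real n + real K - real N) * t) = exp t ^ (n + K - N)"
    using le by (simp add: of_nat_diff flip: exp_of_nat_mult)
  then show "mgf (distr M borel X) t =
      fact n * fact K / (fact N * fact (n + K - N))
      * exp ((real n + real K - real N) * t)
      * hyp2F1 (real n - real N) (real K - real N) (real n + real K - real N + 1) (exp t)"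
    using assms le by (simp add: distribution mgf_hypergeometric hypergeometric_pgf_hyp2F1_reflected)
  have "exp (\<i> * (of_nat n + of_nat K - of_nat N) * of_real t) = exp (\<i> * of_real t) ^ (n + K - N)"
    using le by (simp add: of_nat_diff mult_ac flip: exp_of_nat_mult)
  then show "char (distr M borel X) t =
      fact n * fact K / (fact N * fact (n + K - N))
      * exp (\<i> * (of_nat n + of_nat K - of_nat N) * of_real t)
      * hyp2F1 (of_nat n - of_nat N) (of_nat K - of_nat N)
          (of_nat n + of_nat K - of_nat N + 1) (exp (\<i> * of_real t))"
    using assms le by (simp add: distribution char_hypergeometric hypergeometric_pgf_hyp2F1_reflected)
qed

end
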